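(* Let $\mathcal{S}=\{1,\ldots,S\}$ and let $Q(\cdot)$ be a nonlinear generator such that the map $Q:\mathcal{P}(\mathcal{S})\rightarrow\mathbb{R}^{S\times S}$ is continuous. Then the nonlinear Markov chain with generator $Q(\cdot)$ has an invariant distribution, that is, there exists $m\in\mathcal{P}(\mathcal{S})$ with $0=m^TQ(m)$.
   Context: $\mathcal{P}(\mathcal{S})=\{m\in\mathbb{R}^S: m_i\ge 0,\ \sum_{i\in\mathcal{S}}m_i=1\}$ is the probability simplex over the finite state space $\mathcal{S}=\{1,\ldots,S\}$. A transition rate matrix is a real $S\times S$ matrix with non-negative off-diagonal entries and all row sums equal to $0$ (conservative). A transition rate matrix function is a map $Q:\mathcal{P}(\mathcal{S})\to\mathbb{R}^{S\times S}$ such that $Q(m)$ is a transition rate matrix for every $m\in\mathcal{P}(\mathcal{S})$. A continuous family of nonlinear transition probabilities is a family of stochastic matrices $P(t,m)=(P_{ij}(t,m))_{i,j\in\mathcal{S}}$ depending continuously on $t\ge 0$ and $m\in\mathcal{P}(\mathcal{S})$ and satisfying the nonlinear Chapman-Kolmogorov equation $\sum_i m_iP_{ij}(t+s,m)=\sum_{i,k}m_iP_{ik}(t,m)P_{kj}(s,\sum_l m_lP_l(t,m))$, where $P_l(t,m)$ denotes the $l$-th row. It yields a nonlinear Markov semigroup $(\Phi^t(\cdot))_{t\ge0}$ of continuous transformations of $\mathcal{P}(\mathcal{S})$ via $\Phi^t_j(m)=\sum_i m_iP_{ij}(t,m)$; it satisfies $\Phi^{t+s}=\Phi^t\Phi^s$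 and $\Phi^0(m)=m$. $\Phi^t(m_0)$ is the marginal distribution at time $t$ of the nonlinear Markov chain with initial distribution $m_0$. A transition rate matrix function $Q$ is the nonlinear (infinitesimal) generator of the semigroup if $\Phi^t(m)$ is differentiable in $t=0$ for all $m\in\mathcal{P}(\mathcal{S})$ and $\left.\frac{\partial}{\partial t}\Phi^t_j(m)\right|_{t=0}=\sum_i m_iQ_{ij}(m)$ for all $j\in\mathcal{S}$ and $m\in\mathcal{P}(\mathcal{S})$. $m\in\mathcal{P}(\mathcal{S})$ is an invariant distribution if $\left.\frac{\partial}{\partial t}\Phi^t(m)\right|_{t=0}=0$; equivalently, if $0=m^TQ(m)$. *)

theory Defs
  imports "HOL-Analysis.Analysis"
begin

text \<open>The state space is a finite index type \<open>'n\<close>, so that \<open>S = CARD('n)\<close>.\<close>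

definition prob_simplex :: "(real ^ 'n) set"
  where "prob_simplex = {m. (\<forall>i. 0 \<le> m $ i) \<and> (\<Sum>i\<in>UNIV. m $ i) = 1}"

definition stochastic_matrix :: "real ^ 'n ^ 'n \<Rightarrow> bool"
  where "stochastic_matrix A \<longleftrightarrow>
    (\<forall>i j. 0 \<le> A $ i $ j) \<and> (\<forall>i. (\<Sum>j\<in>UNIV. A $ i $ j) = 1)"

definition transition_rate_matrix :: "real ^ 'n ^ 'n \<Rightarrow> bool"
  where "transition_rate_matrix A \<longleftrightarrow>
    (\<forall>i j. i \<noteq> j \<longrightarrow> 0 \<le> A $ i $ j) \<and> (\<forall>i. (\<Sum>j\<in>UNIV. A $ i $ j) = 0)"

definition transition_rate_matrix_function :: "(real ^ 'n \<Rightarrow> real ^ 'n ^ 'n) \<Rightarrow> bool"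
  where "transition_rate_matrix_function Q \<longleftrightarrow> (\<forall>m\<in>prob_simplex. transition_rate_matrix (Q m))"

text \<open>Only the values \<open>P t m\<close> with \<open>t \<ge> 0\<close> and \<open>m\<close> in the simplex matter. Continuity is joint
  in \<open>(t, m)\<close>. The last clause is the initial condition \<open>\<Phi>\<^sup>0(m) = m\<close> of the semigroup; the
  Chapman-Kolmogorov equation on its own only makes \<open>\<Phi>\<^sup>0\<close> idempotent.\<close>

definition nonlinear_transition_probabilities ::
    "(real \<Rightarrow> real ^ 'n \<Rightarrow> real ^ 'n ^ 'n) \<Rightarrow> bool"
  where "nonlinear_transition_probabilities P \<longleftrightarrow>
    (\<forall>t\<ge>0. \<forall>m\<in>prob_simplex. stochastic_matrix (P t m)) \<and>
    continuous_on ({0..} \<times> prob_simplex) (\<lambda>(t, m). P t m) \<and>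
    (\<forall>t\<ge>0. \<forall>s\<ge>0. \<forall>m\<in>prob_simplex. \<forall>j.
      (\<Sum>i\<in>UNIV. m $ i * P (t + s) m $ i $ j) =
      (\<Sum>i\<in>UNIV. \<Sum>k\<in>UNIV.
        m $ i * P t m $ i $ k * P s (\<Sum>l\<in>UNIV. m $ l *\<^sub>R row l (P t m)) $ k $ j)) \<and>
    (\<forall>m\<in>prob_simplex. \<forall>j. (\<Sum>i\<in>UNIV. m $ i * P 0 m $ i $ j) = m $ j)"

definition markov_semigroup ::
    "(real \<Rightarrow> real ^ 'n \<Rightarrow> real ^ 'n ^ 'n) \<Rightarrow> real \<Rightarrow> real ^ 'n \<Rightarrow> real ^ 'n"
  where "markov_semigroup P t m = (\<chi> j. \<Sum>i\<in>UNIV. m $ i * P t m $ i $ j)"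

text \<open>Time runs over \<open>t \<ge> 0\<close>, so derivatives at \<open>t = 0\<close> are one-sided.\<close>

definition nonlinear_generator ::
    "(real \<Rightarrow> real ^ 'n \<Rightarrow> real ^ 'n) \<Rightarrow> (real ^ 'n \<Rightarrow> real ^ 'n ^ 'n) \<Rightarrow> bool"
  where "nonlinear_generator \<Phi> Q \<longleftrightarrow>
    transition_rate_matrix_function Q \<and>
    (\<forall>m\<in>prob_simplex. \<forall>j.
      ((\<lambda>t. \<Phi> t m $ j) has_real_derivative (\<Sum>i\<in>UNIV. m $ i * Q m $ i $ j)) (at 0 within {0..}))"

definition invariant_distribution ::
    "(real \<Rightarrow> real ^ 'n \<Rightarrow> real ^ 'n) \<Rightarrow> real ^ 'n \<Rightarrow> bool"
  where "invariant_distribution \<Phi> m \<longleftrightarrow>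
    m \<in> prob_simplex \<and> ((\<lambda>t. \<Phi> t m) has_vector_derivative 0) (at 0 within {0..})"

lemma markov_semigroup_eq: "markov_semigroup P t m = (\<Sum>l\<in>UNIV. m $ l *\<^sub>R row l (P t m))"
  by (simp add: markov_semigroup_def vec_eq_iff row_def)

lemma markov_semigroup_in_simplex:
  assumes "nonlinear_transition_probabilities P" "0 \<le> t" "m \<in> prob_simplex"
  shows "markov_semigroup P t m \<in> prob_simplex"
proof -
  have st: "\<And>i j. 0 \<le> P t m $ i $ j" "\<And>i. (\<Sum>j\<in>UNIV. P t m $ i $ j) = 1"
    using assms by (auto simp: nonlinear_transition_probabilities_def stochastic_matrix_def)
  have m: "\<And>i. 0 \<le> m $ i" "(\<Sum>i\<in>UNIV. m $ i) = 1"
    using assms(3) by (auto simp: prob_simplex_def)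
  have "(\<Sum>j\<in>UNIV. \<Sum>i\<in>UNIV. m $ i * P t m $ i $ j) = (\<Sum>i\<in>UNIV. m $ i * (\<Sum>j\<in>UNIV. P t m $ i $ j))"
    by (subst sum.swap) (simp add: sum_distrib_left)
  then show ?thesis
    using st m by (auto simp: prob_simplex_def markov_semigroup_def intro!: sum_nonneg)
qed

lemma markov_semigroup_0:
  assumes "nonlinear_transition_probabilities P" "m \<in> prob_simplex"
  shows "markov_semigroup P 0 m = m"
  using assms by (simp add: nonlinear_transition_probabilities_def markov_semigroup_def vec_eq_iff)

lemma markov_semigroup_add:
  assumes "nonlinear_transition_probabilities P" "0 \<le> t" "0 \<le> s" "m \<in> prob_simplex"
  shows "markov_semigroup P (t + s) m = markov_semigroup P s (markov_semigroup P t m)"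
proof -
  let ?n = "\<Sum>l\<in>UNIV. m $ l *\<^sub>R row l (P t m)"
  have "markov_semigroup P (t + s) m $ j = markov_semigroup P s (markov_semigroup P t m) $ j" for j
  proof -
    have "markov_semigroup P (t + s) m $ j =
        (\<Sum>i\<in>UNIV. \<Sum>k\<in>UNIV. m $ i * P t m $ i $ k * P s ?n $ k $ j)"
      using assms by (simp add: nonlinear_transition_probabilities_def markov_semigroup_def)
    also have "\<dots> = (\<Sum>k\<in>UNIV. (\<Sum>i\<in>UNIV. m $ i * P t m $ i $ k) * P s ?n $ k $ j)"
      by (subst sum.swap) (simp add: sum_distrib_right)
    also have "\<dots> = markov_semigroup P s (markov_semigroup P t m) $ j"
      unfolding markov_semigroup_eq[of P t m, symmetric] by (simp add: markov_semigroup_def)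
    finally show ?thesis .
  qed
  then show ?thesis by (simp add: vec_eq_iff)
qed

end

theory Submission
  imports Defs
begin

text \<open>The vector field \<open>m \<mapsto> m v* Q m\<close> points into the simplex: its components sum to zero since the
  rows of \<open>Q m\<close> do, and component \<open>j\<close> is at least \<open>m $ j * Q m $ j $ j\<close>, since off-diagonal rates
  are non-negative. Hence a sufficiently short Euler step \<open>m \<mapsto> m + c m *\<^sub>R (m v* Q m)\<close> maps the simplex to
  itself. With \<open>c\<close> positive and continuous, Brouwer's theorem gives a fixed point of this map, and
  such a point is a zero of the vector field. As \<open>m v* Q m\<close> is the derivative of the semigroup at
  time zero, that zero is an invariant distribution.\<close>

lemma convex_prob_simplex: "convex (prob_simplex :: (real ^ 'n) set)"
  by (auto simp: convex_def prob_simplex_def sum.distrib simp flip: sum_distrib_left)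

lemma compact_prob_simplex: "compact (prob_simplex :: (real ^ 'n) set)"
proof -
  have "closed (prob_simplex :: (real ^ 'n) set)"
    unfolding prob_simplex_def
    by (intro closed_Collect_conj closed_Collect_all closed_Collect_le closed_Collect_eq
        continuous_intros)
  moreover have "bounded (prob_simplex :: (real ^ 'n) set)"
  proof (rule boundedI)
    fix m :: "real ^ 'n"
    assume "m \<in> prob_simplex"
    then have "(\<Sum>i\<in>UNIV. \<bar>m $ i\<bar>) = 1"
      by (simp add: prob_simplex_def)
    then show "norm m \<le> 1"
      using norm_le_l1_cart[of m] by simp
  qed
  ultimately show ?thesis
    by (simp add: compact_eq_bounded_closed)
qed

lemma prob_simplex_nonempty: "(prob_simplex :: (real ^ 'n) set) \<noteq> {}"
proof -
  have "axis undefined 1 \<in> (prob_simplex :: (real ^ 'n) set)"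
    by (simp add: prob_simplex_def axis_def)
  then show ?thesis by blast
qed

text \<open>The condition on \<open>c\<close> says that the matrix \<open>mat 1 + c *\<^sub>R A\<close> has a non-negative diagonal,
  hence is stochastic.\<close>

lemma euler_step_in_prob_simplex:
  fixes A :: "real ^ 'n ^ 'n"
  assumes A: "transition_rate_matrix A" and m: "m \<in> prob_simplex"
    and c: "0 \<le> c" "\<And>j. c * \<bar>A $ j $ j\<bar> \<le> 1"
  shows "m + c *\<^sub>R (m v* A) \<in> prob_simplex"
proof -
  have m0: "0 \<le> m $ i" for i
    using m by (simp add: prob_simplex_def)
  have "0 \<le> (m + c *\<^sub>R (m v* A)) $ j" for j
  proof -
    have "m $ j * A $ j $ j \<le> (\<Sum>i\<in>UNIV. m $ i * A $ i $ j)"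
      using A m0
      by (subst sum.remove[of _ j])
        (auto simp: transition_rate_matrix_def intro!: sum_nonneg mult_nonneg_nonneg)
    then have "c * (m $ j * A $ j $ j) \<le> c * (m v* A) $ j"
      using c(1) by (simp add: vector_matrix_mult_def mult.commute mult_left_mono)
    moreover have "- 1 \<le> c * A $ j $ j"
      using c(2)[of j] abs_ge_minus_self[of "c * A $ j $ j"] c(1) by (simp add: abs_mult)
    then have "m $ j * (- 1) \<le> m $ j * (c * A $ j $ j)"
      using m0 by (rule mult_left_mono)
    ultimately show ?thesis
      by (simp add: mult.left_commute)
  qed
  moreover have "(\<Sum>j\<in>UNIV. (m v* A) $ j) = (\<Sum>i\<in>UNIV. m $ i * (\<Sum>j\<in>UNIV. A $ i $ j))"
    unfolding vector_matrix_mult_def sum_distrib_left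
    by (simp add: mult.commute) (rule sum.swap)
  then have "(\<Sum>j\<in>UNIV. (m v* A) $ j) = 0"
    using A by (simp add: transition_rate_matrix_def)
  ultimately show ?thesis
    using m by (simp add: prob_simplex_def sum.distrib flip: sum_distrib_left)
qed

lemma transition_rate_matrix_function_zero:
  fixes Q :: "real ^ 'n \<Rightarrow> real ^ 'n ^ 'n"
  assumes Q: "transition_rate_matrix_function Q" and cont: "continuous_on prob_simplex Q"
  obtains m where "m \<in> prob_simplex" "m v* Q m = 0"
proof -
  \<comment> \<open>A step length depending continuously on \<open>m\<close>, which avoids a uniform bound on the rates.\<close>
  define c where "c m = 1 / (1 + (\<Sum>j\<in>UNIV. \<bar>Q m $ j $ j\<bar>))" for m
  define f where "f m = m + c m *\<^sub>R (m v* Q m)" for m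
  have pos: "0 < 1 + (\<Sum>j\<in>UNIV. \<bar>Q m $ j $ j\<bar>)" for m
    by (rule add_pos_nonneg) (auto intro: sum_nonneg)
  have c_pos: "0 < c m" for m
    using pos by (simp add: c_def)
  have c_le: "c m * \<bar>Q m $ j $ j\<bar> \<le> 1" for m j
  proof -
    have "\<bar>Q m $ j $ j\<bar> \<le> (\<Sum>j\<in>UNIV. \<bar>Q m $ j $ j\<bar>)"
      by (rule member_le_sum) auto
    then show ?thesis
      using pos[of m] by (simp add: c_def divide_simps)
  qed
  have "continuous_on prob_simplex c"
    unfolding c_def using pos by (intro continuous_intros cont) (simp add: less_imp_neq[symmetric])
  moreover have "continuous_on prob_simplex (\<lambda>m. m v* Q m)"
    unfolding vector_matrix_mult_def by (intro continuous_intros cont)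
  ultimately have "continuous_on prob_simplex f"
    unfolding f_def by (intro continuous_intros)
  moreover have "f \<in> prob_simplex \<rightarrow> prob_simplex"
    using Q c_pos c_le
    by (auto simp: f_def transition_rate_matrix_function_def less_imp_le
        intro!: euler_step_in_prob_simplex)
  ultimately obtain m where "m \<in> prob_simplex" "f m = m"
    using brouwer[OF compact_prob_simplex convex_prob_simplex prob_simplex_nonempty] by blast
  moreover from this have "m v* Q m = 0"
    using c_pos[of m] by (simp add: f_def)
  ultimately show thesis
    using that by blast
qed

lemma nonlinear_generator_has_vector_derivative:
  fixes Q :: "real ^ 'n \<Rightarrow> real ^ 'n ^ 'n"
  assumes "nonlinear_generator \<Phi> Q" "m \<in> prob_simplex"
  shows "((\<lambda>t. \<Phi> t m) has_vector_derivative m v* Q m) (at 0 within {0..})"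
proof -
  have "((\<lambda>t. \<Phi> t m $ j) has_vector_derivative (m v* Q m) $ j) (at 0 within {0..})" for j
    using assms
    by (simp add: nonlinear_generator_def vector_matrix_mult_def mult.commute
        flip: has_real_derivative_iff_has_vector_derivative)
  then show ?thesis
    unfolding has_vector_derivative_def
    by (subst has_derivative_componentwise_within) (auto simp: Basis_vec_def inner_axis)
qed

theorem theorem3p1:
  fixes P :: "real \<Rightarrow> real ^ 'n \<Rightarrow> real ^ 'n ^ 'n"
    and Q :: "real ^ 'n \<Rightarrow> real ^ 'n ^ 'n"
  assumes "nonlinear_transition_probabilities P"
    and "nonlinear_generator (markov_semigroup P) Q"
    and "continuous_on prob_simplex Q"
  shows "\<exists>m\<in>prob_simplex. invariant_distribution (markov_semigroup P) m \<and> 0 = m v* Q m"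
proof -
  have "transition_rate_matrix_function Q"
    using assms(2) by (simp add: nonlinear_generator_def)
  then obtain m where m: "m \<in> prob_simplex" "m v* Q m = 0"
    using transition_rate_matrix_function_zero assms(3) by blast
  then show ?thesis
    using nonlinear_generator_has_vector_derivative[OF assms(2) m(1)]
    by (auto simp: invariant_distribution_def)
qed

end
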